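(* Let $n\ge 1$ be an integer. For every integer $k$ with $n+2\le k\le 2n$, the number $f_k(2n)$ of vertices of degree $k$ in the origami flip graph $\mathrm{OFG}(A_{2n})$ is $$f_k(2n)=\frac{4n}{n+1}\binom{n+1}{k-n-1}\binom{n-2}{k-n-2}.$$
   Context: $A_{2n}$ is the crease pattern with a single interior vertex of degree $2n$, creases $e_1,\dots,e_{2n}$ in cyclic order, all consecutive angles equal to $\pi/n$, and faces $\alpha_1,\dots,\alpha_{2n}$, where $\alpha_i$ is the face between $e_i$ and $e_{i+1}$ (indices cyclic mod $2n$). A mountain-valley (MV) assignment is a function $\mu:\{e_1,\dots,e_{2n}\}\to\{-1,1\}$ ($1$ = mountain, $-1$ = valley). It is valid if it can be used to fold the paper flat without self-intersection; for $A_{2n}$ this is known to be equivalent to $\sum_{i=1}^{2n}\mu(e_i)=\pm 2$, which may be taken as the definition. For a face $\alpha_i$, $\mu_{\alpha_i}$ denotes the MV assignment obtained from $\mu$ by changing the sign on exactly the two creases $e_i,e_{i+1}$ bordering $\alpha_i$. The origami flip graph $\mathrm{OFG}(A_{2n})$ is the simple undirected graph whose vertices are all valid MV assignments of $A_{2n}$, with $\mu$ and $\nu$ joined by an edge if and only if $\nu=\mu_{\alpha_i}$ for some face $\alpha_i$. (For $n=1$ the range of $k$ is empty.) *)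

theory Defs
  imports Complex_Main "HOL-Library.FuncSet"
begin

text \<open>
  The creases and the faces of the crease pattern with a single vertex of degree \<open>2n\<close> and
  all consecutive angles equal are both represented by their indices in \<open>{1..2 * n}\<close>.
\<close>

text \<open>
  Face \<open>i\<close> lies between crease \<open>i\<close> and its cyclic successor, so that face \<open>2 * n\<close> is bordered
  by the creases \<open>2 * n\<close> and \<open>1\<close>.
\<close>

definition face_creases :: "nat \<Rightarrow> nat \<Rightarrow> nat set" where
  "face_creases n i = {i, (if i = 2 * n then 1 else i + 1)}"

text \<open>
  Mountain is \<open>1\<close> and valley is \<open>-1\<close>.  Assignments are taken extensional, i.e. with a fixed
  value outside the set of creases, so that each assignment is counted exactly once.
\<close>

definition MV_assignments :: "nat \<Rightarrow> (nat \<Rightarrow> int) set" where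
  "MV_assignments n = {1..2 * n} \<rightarrow>\<^sub>E {-1, 1}"

text \<open>
  Flat-foldability of this crease pattern is expressed by Maekawa's condition, which is
  necessary and sufficient since all angles are equal.
\<close>

definition valid_MV :: "nat \<Rightarrow> (nat \<Rightarrow> int) \<Rightarrow> bool" where
  "valid_MV n \<mu> \<longleftrightarrow> \<mu> \<in> MV_assignments n \<and> (\<Sum>i = 1..2 * n. \<mu> i) \<in> {2, -2}"

definition face_flip :: "nat \<Rightarrow> nat \<Rightarrow> (nat \<Rightarrow> int) \<Rightarrow> nat \<Rightarrow> int" where
  "face_flip n i \<mu> = (\<lambda>j. if j \<in> face_creases n i then - \<mu> j else \<mu> j)"

definition OFG_verts :: "nat \<Rightarrow> (nat \<Rightarrow> int) set" where
  "OFG_verts n = {\<mu>. valid_MV n \<mu>}"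

text \<open>
  Edges are unordered pairs, so two faces giving the same flip (which happens only for
  \<open>n = 1\<close>) contribute a single edge.
\<close>

definition OFG_edges :: "nat \<Rightarrow> (nat \<Rightarrow> int) set set" where
  "OFG_edges n = {{\<mu>, \<nu>} | \<mu> \<nu>. \<mu> \<in> OFG_verts n \<and> \<nu> \<in> OFG_verts n \<and>
                     (\<exists>i\<in>{1..2 * n}. \<nu> = face_flip n i \<mu>)}"

definition OFG_degree :: "nat \<Rightarrow> (nat \<Rightarrow> int) \<Rightarrow> nat" where
  "OFG_degree n \<mu> = card {e \<in> OFG_edges n. \<mu> \<in> e}"

definition num_degree :: "nat \<Rightarrow> nat \<Rightarrow> nat" where
  "num_degree n k = card {\<mu> \<in> OFG_verts n. OFG_degree n \<mu> = k}"

text \<open>The graph has no loops.\<close>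

lemma OFG_edges_card:
  assumes "e \<in> OFG_edges n"
  shows "card e = 2"
proof -
  obtain \<mu> i where e: "e = {\<mu>, face_flip n i \<mu>}" and \<mu>: "\<mu> \<in> OFG_verts n"
    and i: "i \<in> {1..2 * n}"
    using assms unfolding OFG_edges_def by blast
  have "\<mu> i \<in> {-1, 1}"
    using \<mu> i unfolding OFG_verts_def valid_MV_def MV_assignments_def by blast
  then have "face_flip n i \<mu> i \<noteq> \<mu> i"
    by (auto simp: face_flip_def face_creases_def)
  then have "\<mu> \<noteq> face_flip n i \<mu>"
    by metis
  then show ?thesis
    by (simp add: e)
qed

end

theory Submission
  imports Defs
begin

text \<open>
  Up to exchanging mountains and valleys, a valid assignment has \<open>n + 1\<close> creases of one sign
  \<open>\<sigma>\<close> and \<open>n - 1\<close> creases of the sign \<open>- \<sigma>\<close>; call the latter the minority.  Flipping a face whose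
  two creases differ preserves the sum, flipping two creases of the majority sign moves the sum
  from \<open>2 * \<sigma>\<close> to \<open>- 2 * \<sigma>\<close>, and flipping two creases of the minority sign moves it to \<open>6 * \<sigma>\<close>.
  The range of \<open>k\<close> forces \<open>n \<ge> 2\<close>, where different faces give different edges.  So the degree is
  \<open>2 * n\<close> minus the number of cyclically adjacent pairs inside the minority.  If
  the minority forms \<open>b\<close> cyclic blocks, there are \<open>n - 1 - b\<close> such pairs and the degree is
  \<open>n + 1 + b\<close> (lemma \<open>OFG_degree_minority\<close>).

  What remains is to count the cyclic words with \<open>p = n + 1\<close> majority letters, \<open>m = n - 1\<close>
  minority letters and \<open>b = k - n - 1\<close> minority blocks.  The cyclic word is cut open before crease
  \<open>1\<close>, and the status of crease \<open>2 * n\<close> is used as the status of a fictitious crease \<open>0\<close>.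
  If crease \<open>2 * n\<close> is in the minority, the \<open>p\<close> majority letters form \<open>b\<close> nonempty runs,
  while the minority letters form \<open>b + 1\<close> runs of which only the first one may be empty.  This
  gives \<open>(p - 1 choose b - 1) * (m choose b)\<close> words.  The other case exchanges the roles of \<open>p\<close> and
  \<open>m\<close>.  The lemmas \<open>card_words_from_minority\<close> and \<open>card_words_from_majority\<close> prove these
  counts by removing the last letter.  The sum of the two is
  \<open>(m + p) * b / (m * p) * (p choose b) * (m choose b)\<close>, which is
  \<open>2 * n / (n + 1) * (n + 1 choose b) * (n - 2 choose b - 1)\<close>, and the choice of \<open>\<sigma>\<close> doubles it.
\<close>

section \<open>Words with a given number of blocks\<close>

text \<open>
  The number of ways to write \<open>p\<close> as an ordered sum of \<open>b\<close> positive integers.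
\<close>

fun compositions :: "nat \<Rightarrow> nat \<Rightarrow> nat" where
  "compositions 0 0 = 1"
| "compositions 0 (Suc b) = 0"
| "compositions (Suc p) 0 = 0"
| "compositions (Suc p) (Suc b) = p choose b"

lemma compositions_Suc_Suc:
  "compositions (Suc p) (Suc b) = compositions p b + compositions p (Suc b)"
  by (cases p; cases b) auto

lemma times_compositions: "p * compositions p b = b * (p choose b)"
  by (cases p; cases b) (simp_all add: Suc_times_binomial_eq mult.commute del: mult_Suc)

text \<open>
  A word with letters at the positions \<open>1, 2, \<dots>\<close> is given by the set \<open>A\<close> of its minority positions.
  The flag \<open>s\<close> says whether the letter at position \<open>0\<close>, which is not part of \<open>A\<close>, is a
  minority letter.
\<close>

definition minority_at :: "bool \<Rightarrow> nat set \<Rightarrow> nat \<Rightarrow> bool" where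
  "minority_at s A i = (if i = 0 then s else i \<in> A)"

definition block_starts :: "bool \<Rightarrow> nat set \<Rightarrow> nat set" where
  "block_starts s A = {i \<in> A. \<not> minority_at s A (i - 1)}"

text \<open>
  The parameters \<open>p\<close>, \<open>m\<close> and \<open>b\<close> count majority letters, minority letters and the starts of
  minority blocks; \<open>s\<close> and \<open>t\<close> fix the letter at position \<open>0\<close> and the last letter.
\<close>

definition words :: "bool \<Rightarrow> bool \<Rightarrow> nat \<Rightarrow> nat \<Rightarrow> nat \<Rightarrow> nat set set" where
  "words s t p m b =
     {A. A \<subseteq> {1..p + m} \<and> card A = m \<and> card (block_starts s A) = b \<and>
         minority_at s A (p + m) = t}"

lemma finite_words: "finite (words s t p m b)"
  by (rule finite_subset[of _ "Pow {1..p + m}"]) (auto simp: words_def)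

lemma words_disjoint: "words s True p m b \<inter> words s False p m b' = {}"
  by (auto simp: words_def)

lemma block_starts_insert:
  assumes "A \<subseteq> {1..N}"
  shows "block_starts s (insert (Suc N) A) =
    (if minority_at s A N then block_starts s A else insert (Suc N) (block_starts s A))"
  using assms by (force simp: block_starts_def minority_at_def split: if_splits)

lemma card_block_starts_insert:
  assumes "A \<subseteq> {1..N}"
  shows "card (block_starts s (insert (Suc N) A)) =
    (if minority_at s A N then card (block_starts s A) else Suc (card (block_starts s A)))"
proof -
  have "block_starts s A \<subseteq> {1..N}"
    using assms by (auto simp: block_starts_def)
  then have "finite (block_starts s A)" "Suc N \<notin> block_starts s A"
    by (auto intro: finite_subset)
  then show ?thesis
    by (simp add: block_starts_insert[OF assms])
qed

lemma words_last_majority: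
  "words s False (Suc p) m b = words s True p m b \<union> words s False p m b"
proof -
  have *: "A \<subseteq> {1..Suc (p + m)} \<and> \<not> minority_at s A (Suc (p + m)) \<longleftrightarrow> A \<subseteq> {1..p + m}" for A
    by (auto simp: minority_at_def subset_iff le_Suc_eq)
  show ?thesis
    using * by (auto simp: words_def)
qed

lemma card_words_last_majority:
  "card (words s False (Suc p) m b) = card (words s True p m b) + card (words s False p m b)"
  by (simp add: words_last_majority card_Un_disjoint finite_words words_disjoint)

lemma words_last_minority:
  "words s True p (Suc m) b =
     insert (Suc (p + m)) ` (words s True p m b \<union> (\<Union>c\<in>{c. Suc c = b}. words s False p m c))"
    (is "?L = ?R")
proof (intro equalityI subsetI)
  fix A assume "A \<in> ?L"
  then have A: "A \<subseteq> {1..Suc (p + m)}" "card A = Suc m" "card (block_starts s A) = b"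
      "Suc (p + m) \<in> A"
    by (auto simp: words_def minority_at_def)
  define B where "B = A - {Suc (p + m)}"
  have AB: "A = insert (Suc (p + m)) B" and B: "B \<subseteq> {1..p + m}"
    using A by (auto simp: B_def le_Suc_eq subset_iff)
  have "card B = m"
    using A by (simp add: B_def)
  then have "B \<in> words s True p m b \<union> (\<Union>c\<in>{c. Suc c = b}. words s False p m c)"
    using A(3) B unfolding AB
    by (auto simp: words_def card_block_starts_insert split: if_splits)
  then show "A \<in> ?R"
    unfolding AB by (rule imageI)
next
  fix A assume "A \<in> ?R"
  then obtain B where AB: "A = insert (Suc (p + m)) B"
    and BW: "B \<in> words s True p m b \<union> (\<Union>c\<in>{c. Suc c = b}. words s False p m c)"
    by blast
  have B: "B \<subseteq> {1..p + m}" "card B = m"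
    using BW by (auto simp: words_def)
  have "finite B" "Suc (p + m) \<notin> B"
    using B finite_subset by auto
  then have "card A = Suc m"
    using B by (simp add: AB)
  moreover have "card (block_starts s A) = b"
    using BW unfolding AB card_block_starts_insert[OF B(1)]
    by (auto simp: words_def)
  moreover have "A \<subseteq> {1..p + Suc m}"
    using B(1) by (auto simp: AB)
  ultimately show "A \<in> ?L"
    by (auto simp: words_def AB minority_at_def)
qed

lemma inj_on_insert_last:
  assumes "\<And>A. A \<in> \<A> \<Longrightarrow> A \<subseteq> {1..N}"
  shows "inj_on (insert (Suc N)) \<A>"
proof (rule inj_onI)
  fix A B assume "A \<in> \<A>" "B \<in> \<A>" and eq: "insert (Suc N) A = insert (Suc N) B"
  then have "Suc N \<notin> A" "Suc N \<notin> B"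
    using assms by fastforce+
  then show "A = B"
    using eq by (metis insert_ident)
qed

lemma card_words_last_minority:
  "card (words s True p (Suc m) (Suc b)) =
     card (words s True p m (Suc b)) + card (words s False p m b)"
proof -
  have "card (words s True p (Suc m) (Suc b)) =
      card (insert (Suc (p + m)) ` (words s True p m (Suc b) \<union> words s False p m b))"
    by (simp add: words_last_minority)
  also have "\<dots> = card (words s True p m (Suc b) \<union> words s False p m b)"
    by (intro card_image inj_on_insert_last) (auto simp: words_def)
  finally show ?thesis
    by (simp add: card_Un_disjoint finite_words words_disjoint)
qed

lemma card_words_last_minority_0:
  "card (words s True p (Suc m) 0) = card (words s True p m 0)"
proof -
  have "card (words s True p (Suc m) 0) = card (insert (Suc (p + m)) ` words s True p m 0)"
    by (simp add: words_last_minority)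
  also have "\<dots> = card (words s True p m 0)"
    by (intro card_image inj_on_insert_last) (auto simp: words_def)
  finally show ?thesis .
qed

text \<open>The boundary cases: the empty word, and words that lack the letter they should end with.\<close>

lemma words_empty: "words s t 0 0 b = (if s = t \<and> b = 0 then {{}} else {})"
  by (auto simp: words_def minority_at_def block_starts_def)

lemma words_minority_missing: "words s True (Suc p) 0 b = {}"
proof -
  have "\<not> minority_at s A (Suc p)" if "A \<subseteq> {1..Suc p}" "card A = 0" for A
    using that finite_subset[OF that(1)] by (auto simp: minority_at_def)
  then show ?thesis
    by (auto simp: words_def)
qed

lemma words_majority_missing: "words s False 0 (Suc m) b = {}"
proof -
  have "minority_at s A (Suc m)" if "A \<subseteq> {1..Suc m}" "card A = Suc m" for A
  proof -
    have "A = {1..Suc m}"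
      by (rule card_subset_eq) (simp_all only: that finite_atLeastAtMost card_atLeastAtMost diff_Suc_1)
    then show ?thesis
      by (simp add: minority_at_def)
  qed
  then show ?thesis
    by (auto simp: words_def)
qed

text \<open>
  If position \<open>0\<close> holds a minority letter, then in a word with \<open>b\<close> block starts the minority letters
  form \<open>b + 1\<close> runs of which the first one may be empty, which leaves \<open>m choose b\<close> possibilities.  The
  majority letters form nonempty runs, one before each block start and one more if the word
  ends with a majority letter.
\<close>

lemma card_words_from_minority:
  "card (words True True p m b) = compositions p b * (m choose b) \<and>
   card (words True False p m b) = compositions p (Suc b) * (m choose b)"
proof (induction "p + m" arbitrary: p m b)
  case 0
  then show ?case
    by (cases b) (auto simp: words_empty)
next
  case (Suc N)
  have "card (words True True p m b) = compositions p b * (m choose b)"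
  proof (cases m)
    case 0
    then obtain q where "p = Suc q"
      using Suc.hyps(2) by (cases p) auto
    with 0 show ?thesis
      by (cases b) (auto simp: words_minority_missing)
  next
    case m: (Suc m')
    have IH: "card (words True True p m' c) = compositions p c * (m' choose c)"
        "card (words True False p m' c) = compositions p (Suc c) * (m' choose c)" for c
      using Suc.hyps(1)[of p m' c] Suc.hyps(2) m by auto
    show ?thesis
    proof (cases b)
      case 0
      then show ?thesis
        by (simp add: m card_words_last_minority_0 IH)
    next
      case (Suc c)
      then show ?thesis
        by (simp add: m card_words_last_minority IH algebra_simps)
    qed
  qed
  moreover have "card (words True False p m b) = compositions p (Suc b) * (m choose b)"
  proof (cases p)
    case 0
    then obtain q where "m = Suc q"
      using Suc.hyps(2) by (cases m) auto
    with 0 show ?thesis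
      by (auto simp: words_majority_missing)
  next
    case p: (Suc p')
    have IH: "card (words True True p' m c) = compositions p' c * (m choose c)"
        "card (words True False p' m c) = compositions p' (Suc c) * (m choose c)" for c
      using Suc.hyps(1)[of p' m c] Suc.hyps(2) p by auto
    show ?thesis
      by (simp add: p card_words_last_majority IH compositions_Suc_Suc algebra_simps
               del: compositions.simps)
  qed
  ultimately show ?case ..
qed

text \<open>
  If position \<open>0\<close> holds a majority letter, the possibly empty first run is one of majority letters,
  and every minority run is a block with a start of its own.  A word that ends with a minority
  letter has as many majority runs as blocks, so that it has at least one block.
\<close>

lemma card_words_from_majority:
  "card (words False False p m b) = (p choose b) * compositions m b \<and>
   card (words False True p m b) = (case b of 0 \<Rightarrow> 0 | Suc c \<Rightarrow> (p choose c) * compositions m b)"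
proof (induction "p + m" arbitrary: p m b)
  case 0
  then show ?case
    by (cases b) (auto simp: words_empty)
next
  case (Suc N)
  have "card (words False True p m b) =
      (case b of 0 \<Rightarrow> 0 | Suc c \<Rightarrow> (p choose c) * compositions m b)"
  proof (cases m)
    case 0
    then obtain q where "p = Suc q"
      using Suc.hyps(2) by (cases p) auto
    with 0 show ?thesis
      by (cases b) (auto simp: words_minority_missing)
  next
    case m: (Suc m')
    have IH: "card (words False False p m' c) = (p choose c) * compositions m' c"
        "card (words False True p m' c) =
          (case c of 0 \<Rightarrow> 0 | Suc d \<Rightarrow> (p choose d) * compositions m' c)" for c
      using Suc.hyps(1)[of p m' c] Suc.hyps(2) m by auto
    show ?thesis
    proof (cases b)
      case 0
      then show ?thesis
        by (simp add: m card_words_last_minority_0 IH)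
    next
      case (Suc c)
      then show ?thesis
        by (simp add: m card_words_last_minority IH compositions_Suc_Suc algebra_simps
                 del: compositions.simps)
    qed
  qed
  moreover have "card (words False False p m b) = (p choose b) * compositions m b"
  proof (cases p)
    case 0
    then obtain q where "m = Suc q"
      using Suc.hyps(2) by (cases m) auto
    with 0 show ?thesis
      by (cases b) (auto simp: words_majority_missing)
  next
    case p: (Suc p')
    have IH: "card (words False False p' m c) = (p' choose c) * compositions m c"
        "card (words False True p' m c) =
          (case c of 0 \<Rightarrow> 0 | Suc d \<Rightarrow> (p' choose d) * compositions m c)" for c
      using Suc.hyps(1)[of p' m c] Suc.hyps(2) p by auto
    show ?thesis
      by (cases b) (simp_all add: p card_words_last_majority IH algebra_simps)
  qed
  ultimately show ?case by simp
qed

text \<open>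
  With the status of the last position as the flag for position \<open>0\<close>, a block that runs across the
  cut is not counted a second time at position \<open>1\<close>, so that block starts are counted cyclically.
\<close>

definition cyclic_words :: "nat \<Rightarrow> nat \<Rightarrow> nat \<Rightarrow> nat set set" where
  "cyclic_words p m b =
     {A. A \<subseteq> {1..p + m} \<and> card A = m \<and> card (block_starts (p + m \<in> A) A) = b}"

lemma card_cyclic_words:
  assumes "p + m > 0"
  shows "card (cyclic_words p m b) = compositions p b * (m choose b) + (p choose b) * compositions m b"
proof -
  have "cyclic_words p m b = words True True p m b \<union> words False False p m b"
  proof (rule set_eqI)
    fix A
    show "A \<in> cyclic_words p m b \<longleftrightarrow> A \<in> words True True p m b \<union> words False False p m b"
      using assms by (cases "p + m \<in> A") (auto simp: cyclic_words_def words_def minority_at_def)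
  qed
  moreover have "words True True p m b \<inter> words False False p m b = {}"
    using assms by (auto simp: words_def minority_at_def)
  ultimately show ?thesis
    by (simp add: card_Un_disjoint finite_words card_words_from_minority card_words_from_majority)
qed

section \<open>Flips and degrees\<close>

definition next_crease :: "nat \<Rightarrow> nat \<Rightarrow> nat" where
  "next_crease n i = (if i = 2 * n then 1 else i + 1)"

lemma face_creases_eq: "face_creases n i = {i, next_crease n i}"
  by (simp add: face_creases_def next_crease_def)

lemma next_crease_in: "i \<in> {1..2 * n} \<Longrightarrow> next_crease n i \<in> {1..2 * n}"
  by (auto simp: next_crease_def)

lemma next_crease_neq: "i \<in> {1..2 * n} \<Longrightarrow> next_crease n i \<noteq> i"
  by (auto simp: next_crease_def)

lemma inj_on_next_crease: "inj_on (next_crease n) {1..2 * n}"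
  by (auto simp: inj_on_def next_crease_def split: if_splits)

lemma face_flip_face_flip [simp]: "face_flip n i (face_flip n i \<mu>) = \<mu>"
  by (auto simp: face_flip_def)

lemma face_flip_in_MV:
  assumes "\<mu> \<in> MV_assignments n" and "i \<in> {1..2 * n}"
  shows "face_flip n i \<mu> \<in> MV_assignments n"
proof -
  have "face_creases n i \<subseteq> {1..2 * n}"
    using assms(2) next_crease_in by (auto simp: face_creases_eq)
  then show ?thesis
    using assms(1) unfolding MV_assignments_def face_flip_def
    by (fastforce simp: PiE_iff extensional_def)
qed

lemma sum_face_flip:
  assumes "i \<in> {1..2 * n}"
  shows "(\<Sum>j = 1..2 * n. face_flip n i \<mu> j) =
    (\<Sum>j = 1..2 * n. \<mu> j) - 2 * (\<mu> i + \<mu> (next_crease n i))"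
proof -
  have sub: "face_creases n i \<subseteq> {1..2 * n}"
    using assms next_crease_in by (auto simp: face_creases_eq)
  have "(\<Sum>j = 1..2 * n. face_flip n i \<mu> j) =
      (\<Sum>j = 1..2 * n. \<mu> j - (if j \<in> face_creases n i then 2 * \<mu> j else 0))"
    by (rule sum.cong) (auto simp: face_flip_def)
  also have "\<dots> = (\<Sum>j = 1..2 * n. \<mu> j) - (\<Sum>j \<in> {1..2 * n} \<inter> face_creases n i. 2 * \<mu> j)"
    by (simp only: sum_subtractf sum.inter_restrict finite_atLeastAtMost)
  also have "{1..2 * n} \<inter> face_creases n i = {i, next_crease n i}"
    using sub by (auto simp: face_creases_eq)
  finally show ?thesis
    using next_crease_neq[OF assms] by auto
qed

text \<open>
  A flip determines the pair of creases that it changes, and this pair determines the face because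
  \<open>n \<ge> 2\<close> (for \<open>n = 1\<close> both faces have the same two creases).  Hence the edges at \<open>\<mu>\<close> correspond to
  the faces that can be flipped.
\<close>

lemma inj_on_face_flip:
  assumes "n \<ge> 2" and "\<mu> \<in> MV_assignments n"
  shows "inj_on (\<lambda>i. face_flip n i \<mu>) {1..2 * n}"
proof (rule inj_onI)
  fix i j assume ij: "i \<in> {1..2 * n}" "j \<in> {1..2 * n}"
    and eq: "face_flip n i \<mu> = face_flip n j \<mu>"
  have changed: "face_creases n i = {l \<in> {1..2 * n}. face_flip n i \<mu> l \<noteq> \<mu> l}"
    if "i \<in> {1..2 * n}" for i
  proof -
    have "\<mu> l \<noteq> 0" if "l \<in> {1..2 * n}" for l
      using assms(2) that by (force simp: MV_assignments_def PiE_iff)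
    moreover have "face_creases n i \<subseteq> {1..2 * n}"
      using \<open>i \<in> _\<close> next_crease_in by (auto simp: face_creases_eq)
    ultimately show ?thesis
      by (auto simp: face_flip_def)
  qed
  have "face_creases n i = face_creases n j"
    using changed[OF ij(1)] changed[OF ij(2)] eq by simp
  then show "i = j"
    using ij assms(1) by (auto simp: face_creases_def doubleton_eq_iff split: if_splits)
qed

lemma OFG_degree_eq_card_faces:
  assumes "n \<ge> 2" and \<mu>: "valid_MV n \<mu>"
  shows "OFG_degree n \<mu> = card {i \<in> {1..2 * n}. valid_MV n (face_flip n i \<mu>)}"
proof -
  let ?F = "{i \<in> {1..2 * n}. valid_MV n (face_flip n i \<mu>)}"
  have MV: "\<mu> \<in> MV_assignments n"
    using \<mu> by (simp add: valid_MV_def)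
  have "{e \<in> OFG_edges n. \<mu> \<in> e} = (\<lambda>i. {\<mu>, face_flip n i \<mu>}) ` ?F"
  proof (intro equalityI subsetI)
    fix e assume "e \<in> {e \<in> OFG_edges n. \<mu> \<in> e}"
    then obtain \<nu> i where e: "e = {\<nu>, face_flip n i \<nu>}" "\<mu> \<in> e" "i \<in> {1..2 * n}"
      and valid: "valid_MV n \<nu>" "valid_MV n (face_flip n i \<nu>)"
      unfolding OFG_edges_def OFG_verts_def by blast
    from e consider "\<mu> = \<nu>" | "\<mu> = face_flip n i \<nu>" by blast
    then have "e = {\<mu>, face_flip n i \<mu>} \<and> valid_MV n (face_flip n i \<mu>)"
      by cases (use e valid in auto)
    then show "e \<in> (\<lambda>i. {\<mu>, face_flip n i \<mu>}) ` ?F"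
      using e(3) by blast
  next
    fix e assume "e \<in> (\<lambda>i. {\<mu>, face_flip n i \<mu>}) ` ?F"
    then show "e \<in> {e \<in> OFG_edges n. \<mu> \<in> e}"
      using \<mu> unfolding OFG_edges_def OFG_verts_def by blast
  qed
  moreover have "inj_on (\<lambda>i. {\<mu>, face_flip n i \<mu>}) ?F"
  proof (rule inj_onI)
    fix i j assume "i \<in> ?F" "j \<in> ?F" and eq: "{\<mu>, face_flip n i \<mu>} = {\<mu>, face_flip n j \<mu>}"
    then have "i \<in> {1..2 * n}" "j \<in> {1..2 * n}" by auto
    moreover from eq have "face_flip n i \<mu> = face_flip n j \<mu>"
      by (auto simp: doubleton_eq_iff)
    ultimately show "i = j"
      using inj_on_face_flip[OF assms(1) MV] by (auto dest: inj_onD)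
  qed
  ultimately show ?thesis
    by (simp add: OFG_degree_def card_image)
qed

text \<open>
  The sign \<open>\<sigma>\<close> stands for the majority sign in the sequel, so that mountains and valleys are
  treated alike.
\<close>

definition minority :: "nat \<Rightarrow> int \<Rightarrow> (nat \<Rightarrow> int) \<Rightarrow> nat set" where
  "minority n \<sigma> \<mu> = {i \<in> {1..2 * n}. \<mu> i = - \<sigma>}"

lemma sum_MV_minority:
  assumes "\<sigma> \<in> {1, -1}" and "\<mu> \<in> MV_assignments n"
  shows "(\<Sum>i = 1..2 * n. \<mu> i) = \<sigma> * (2 * int n - 2 * int (card (minority n \<sigma> \<mu>)))"
proof -
  have "\<mu> i = \<sigma> - (if \<mu> i = - \<sigma> then 2 * \<sigma> else 0)" if "i \<in> {1..2 * n}" for i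
  proof -
    have "\<mu> i \<in> {-1, 1}"
      using assms(2) that by (auto simp: MV_assignments_def PiE_iff)
    then show ?thesis
      using assms(1) by auto
  qed
  then have "(\<Sum>i = 1..2 * n. \<mu> i) = (\<Sum>i = 1..2 * n. \<sigma> - (if \<mu> i = - \<sigma> then 2 * \<sigma> else 0))"
    by (rule sum.cong[OF refl])
  also have "\<dots> = 2 * int n * \<sigma> - (\<Sum>i \<in> {i \<in> {1..2 * n}. \<mu> i = - \<sigma>}. 2 * \<sigma>)"
    by (simp only: sum_subtractf sum.inter_filter finite_atLeastAtMost) simp
  also have "\<dots> = \<sigma> * (2 * int n - 2 * int (card (minority n \<sigma> \<mu>)))"
    by (simp add: minority_def algebra_simps)
  finally show ?thesis .
qed

text \<open>
  Flipping two minority creases would bring the sum to \<open>6 * \<sigma>\<close>; all other flips leave it at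
  \<open>2 * \<sigma>\<close> or bring it to \<open>- 2 * \<sigma>\<close>.
\<close>

lemma valid_flip_iff:
  assumes "\<sigma> \<in> {1, -1}" and "\<mu> \<in> MV_assignments n"
    and "(\<Sum>j = 1..2 * n. \<mu> j) = 2 * \<sigma>" and "i \<in> {1..2 * n}"
  shows "valid_MV n (face_flip n i \<mu>) \<longleftrightarrow>
    \<not> (i \<in> minority n \<sigma> \<mu> \<and> next_crease n i \<in> minority n \<sigma> \<mu>)"
proof -
  have "\<mu> i \<in> {-1, 1}" "\<mu> (next_crease n i) \<in> {-1, 1}"
    using assms(2,4) next_crease_in[OF assms(4)] by (auto simp: MV_assignments_def PiE_iff)
  then show ?thesis
    using assms(1,4) face_flip_in_MV[OF assms(2,4)] next_crease_in[OF assms(4)]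
    unfolding valid_MV_def sum_face_flip[OF assms(4)] assms(3) minority_def
    by auto
qed

text \<open>
  Each element of \<open>A\<close> either starts a cyclic block or is the second element of an adjacent pair
  inside \<open>A\<close>; \<open>next_crease\<close> maps the first elements of these pairs bijectively to the second ones.
\<close>

lemma card_adjacent_pairs:
  assumes "A \<subseteq> {1..2 * n}"
  shows "card {i \<in> {1..2 * n}. i \<in> A \<and> next_crease n i \<in> A} + card (block_starts (2 * n \<in> A) A)
    = card A"
proof -
  let ?P = "{i \<in> {1..2 * n}. i \<in> A \<and> next_crease n i \<in> A}"
  let ?S = "block_starts (2 * n \<in> A) A"
  have S: "?S \<subseteq> A"
    unfolding block_starts_def by blast
  have "finite A"
    using assms finite_subset by blast
  have start_iff: "next_crease n i \<in> ?S \<longleftrightarrow> next_crease n i \<in> A \<and> i \<notin> A" if "i \<in> {1..2 * n}" for i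
  proof (cases "i = 2 * n")
    case True
    then show ?thesis
      by (simp add: block_starts_def minority_at_def next_crease_def)
  next
    case False
    then show ?thesis
      using that by (simp add: block_starts_def minority_at_def next_crease_def)
  qed
  have surj: "next_crease n ` {1..2 * n} = {1..2 * n}"
    using next_crease_in by (intro endo_inj_surj inj_on_next_crease image_subsetI) simp_all
  have image: "next_crease n ` ?P = A - ?S"
  proof (intro equalityI subsetI)
    fix j assume "j \<in> next_crease n ` ?P"
    then obtain i where "i \<in> {1..2 * n}" "i \<in> A" "next_crease n i \<in> A" "j = next_crease n i"
      by blast
    then show "j \<in> A - ?S"
      by (simp only: start_iff Diff_iff simp_thms)
  next
    fix j assume j: "j \<in> A - ?S"
    then have "j \<in> next_crease n ` {1..2 * n}"
      unfolding surj using assms by blast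
    then obtain i where i: "i \<in> {1..2 * n}" "j = next_crease n i"
      by blast
    then have "i \<in> ?P"
      using j start_iff[OF i(1)] by simp
    then show "j \<in> next_crease n ` ?P"
      unfolding i(2) by (rule imageI)
  qed
  have "inj_on (next_crease n) ?P"
    using inj_on_next_crease by (rule inj_on_subset) blast
  then have "card ?P = card (A - ?S)"
    unfolding image[symmetric] by (rule card_image[symmetric])
  also have "\<dots> = card A - card ?S"
    by (rule card_Diff_subset[OF finite_subset[OF S \<open>finite A\<close>] S])
  finally show ?thesis
    using card_mono[OF \<open>finite A\<close> S] by linarith
qed

text \<open>
  The faces that cannot be flipped are the \<open>n - 1 - b\<close> adjacent pairs inside the minority, where \<open>b\<close>
  is the number of its cyclic blocks, and \<open>2 * n - (n - 1 - b) = n + 1 + b\<close>.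
\<close>

lemma OFG_degree_minority:
  assumes "n \<ge> 2" and "\<sigma> \<in> {1, -1}" and "\<mu> \<in> MV_assignments n"
    and "(\<Sum>j = 1..2 * n. \<mu> j) = 2 * \<sigma>"
  defines "A \<equiv> minority n \<sigma> \<mu>"
  shows "OFG_degree n \<mu> = n + 1 + card (block_starts (2 * n \<in> A) A)"
proof -
  let ?P = "{i \<in> {1..2 * n}. i \<in> A \<and> next_crease n i \<in> A}"
  have "card A = n - 1"
    using sum_MV_minority[OF assms(2,3)] assms(1,2,4) by (auto simp: A_def)
  have "valid_MV n \<mu>"
    using assms(2-4) by (auto simp: valid_MV_def)
  have "{i \<in> {1..2 * n}. valid_MV n (face_flip n i \<mu>)} = {1..2 * n} - ?P"
    using valid_flip_iff[OF assms(2-4)] by (auto simp: A_def)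
  then have "OFG_degree n \<mu> = card ({1..2 * n} - ?P)"
    by (simp add: OFG_degree_eq_card_faces[OF assms(1) \<open>valid_MV n \<mu>\<close>])
  also have "\<dots> = 2 * n - card ?P"
    by (subst card_Diff_subset) auto
  finally have "OFG_degree n \<mu> = 2 * n - card ?P" .
  moreover have "A \<subseteq> {1..2 * n}"
    unfolding A_def minority_def by blast
  then have "card ?P + card (block_starts (2 * n \<in> A) A) = n - 1"
    using card_adjacent_pairs \<open>card A = n - 1\<close> by simp
  ultimately show ?thesis
    using assms(1) by linarith
qed

section \<open>Counting vertices by degree\<close>

lemma bij_betw_minority:
  assumes "\<sigma> \<in> {1, -1}"
  shows "bij_betw (minority n \<sigma>) (MV_assignments n) (Pow {1..2 * n})"
proof (rule bij_betw_byWitness)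
  let ?g = "\<lambda>A. \<lambda>i\<in>{1..2 * n}. if i \<in> A then - \<sigma> else \<sigma>"
  show "\<forall>\<mu>\<in>MV_assignments n. ?g (minority n \<sigma> \<mu>) = \<mu>"
  proof
    fix \<mu> assume "\<mu> \<in> MV_assignments n"
    then have val: "\<forall>i\<in>{1..2 * n}. \<mu> i \<in> {-1, 1}" and ext: "\<mu> \<in> extensional {1..2 * n}"
      by (auto simp only: MV_assignments_def PiE_iff)
    show "?g (minority n \<sigma> \<mu>) = \<mu>"
    proof (rule extensionalityI[OF restrict_extensional ext])
      fix i assume "i \<in> {1..2 * n}"
      then show "?g (minority n \<sigma> \<mu>) i = \<mu> i"
        using bspec[OF val, of i] assms by (auto simp: minority_def)
    qed
  qed
  show "\<forall>A\<in>Pow {1..2 * n}. minority n \<sigma> (?g A) = A"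
    using assms by (auto simp: minority_def)
  show "minority n \<sigma> ` MV_assignments n \<subseteq> Pow {1..2 * n}"
    by (auto simp: minority_def)
  show "?g ` Pow {1..2 * n} \<subseteq> MV_assignments n"
    using assms by (auto simp: MV_assignments_def split: if_splits)
qed

lemma card_degree_with_majority:
  assumes "n \<ge> 2" and "\<sigma> \<in> {1, -1}"
  shows "card {\<mu> \<in> MV_assignments n. (\<Sum>j = 1..2 * n. \<mu> j) = 2 * \<sigma> \<and> OFG_degree n \<mu> = n + 1 + b}
    = card (cyclic_words (n + 1) (n - 1) b)"
proof -
  let ?V = "{\<mu> \<in> MV_assignments n. (\<Sum>j = 1..2 * n. \<mu> j) = 2 * \<sigma> \<and> OFG_degree n \<mu> = n + 1 + b}"
  have N: "n + 1 + (n - 1) = 2 * n"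
    using assms(1) by simp
  have sum_iff: "(\<Sum>j = 1..2 * n. \<mu> j) = 2 * \<sigma> \<longleftrightarrow> card (minority n \<sigma> \<mu>) = n - 1"
    if "\<mu> \<in> MV_assignments n" for \<mu>
    using sum_MV_minority[OF assms(2) that] assms by auto
  have "?V = {\<mu> \<in> MV_assignments n. minority n \<sigma> \<mu> \<in> cyclic_words (n + 1) (n - 1) b}"
    unfolding cyclic_words_def N
    using sum_iff OFG_degree_minority[OF assms] by (auto simp: minority_def)
  moreover have "cyclic_words (n + 1) (n - 1) b \<subseteq> minority n \<sigma> ` MV_assignments n"
    unfolding bij_betw_imp_surj_on[OF bij_betw_minority[OF assms(2)]] cyclic_words_def N by blast
  ultimately have image: "minority n \<sigma> ` ?V = cyclic_words (n + 1) (n - 1) b"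
    by blast
  have "inj_on (minority n \<sigma>) ?V"
    using bij_betw_imp_inj_on[OF bij_betw_minority[OF assms(2)]] by (rule inj_on_subset) blast
  then show ?thesis
    unfolding image[symmetric] by (rule card_image[symmetric])
qed

lemma num_degree_eq_cyclic_words:
  assumes "n \<ge> 2"
  shows "num_degree n (n + 1 + b) = 2 * card (cyclic_words (n + 1) (n - 1) b)"
proof -
  let ?V = "\<lambda>\<sigma>. {\<mu> \<in> MV_assignments n.
    (\<Sum>j = 1..2 * n. \<mu> j) = 2 * \<sigma> \<and> OFG_degree n \<mu> = n + 1 + b}"
  have "{\<mu> \<in> OFG_verts n. OFG_degree n \<mu> = n + 1 + b} = ?V 1 \<union> ?V (-1)"
    by (auto simp: OFG_verts_def valid_MV_def)
  moreover have "finite (MV_assignments n)"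
    by (simp add: MV_assignments_def finite_PiE)
  then have "card (?V 1 \<union> ?V (-1)) = card (?V 1) + card (?V (-1))"
    by (intro card_Un_disjoint) auto
  ultimately show ?thesis
    using card_degree_with_majority[OF assms, of 1 b] card_degree_with_majority[OF assms, of "-1" b]
    by (simp add: num_degree_def)
qed

theorem theorem5p2:
  fixes n k :: nat
  assumes "n \<ge> 1" and "n + 2 \<le> k" and "k \<le> 2 * n"
  shows "real (num_degree n k) =
    4 * real n / (real n + 1) * real ((n + 1) choose (k - n - 1)) * real ((n - 2) choose (k - n - 2))"
proof -
  have n: "n \<ge> 2"
    using assms by linarith
  obtain b where b: "k = n + 1 + Suc b"
    using assms(2) by (auto simp: le_iff_add)
  obtain m where m: "n = Suc (Suc m)"
    using n by (auto simp: le_iff_add)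
  let ?C = "real ((n + 1) choose Suc b)" and ?D = "real (m choose b)"
  have "num_degree n k =
      2 * (compositions (n + 1) (Suc b) * (Suc m choose Suc b) + ((n + 1) choose Suc b) * (m choose b))"
    unfolding b num_degree_eq_cyclic_words[OF n] by (subst card_cyclic_words) (simp_all add: m)
  then have eq: "real (num_degree n k) =
      2 * (real (compositions (n + 1) (Suc b)) * real (Suc m choose Suc b) + ?C * ?D)"
    by (simp only: of_nat_mult of_nat_add of_nat_numeral)
  \<comment> \<open>Absorption on both factors turns the first summand into a multiple of \<open>?C * ?D\<close> as well.\<close>
  have "(n + 1) * compositions (n + 1) (Suc b) = Suc b * ((n + 1) choose Suc b)"
    by (rule times_compositions)
  then have 1: "real (compositions (n + 1) (Suc b)) = real (Suc b) * ?C / (real n + 1)"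
    unfolding of_nat_eq_iff[where 'a = real, symmetric] of_nat_mult
    by (simp add: field_simps del: compositions.simps binomial_Suc_Suc)
  have "Suc b * (Suc m choose Suc b) = Suc m * (m choose b)"
    by (rule Suc_times_binomial)
  then have 2: "real (Suc b) * real (Suc m choose Suc b) = real (Suc m) * ?D"
    by (simp only: of_nat_mult[symmetric])
  have "real (compositions (n + 1) (Suc b)) * real (Suc m choose Suc b) =
      ?C / (real n + 1) * (real (Suc b) * real (Suc m choose Suc b))"
    unfolding 1 by (simp add: field_simps)
  also have "\<dots> = real (Suc m) / (real n + 1) * ?C * ?D"
    unfolding 2 by simp
  finally have "real (num_degree n k) = 2 * ((real (Suc m) / (real n + 1) + 1) * ?C * ?D)"
    unfolding eq by (simp add: algebra_simps)
  also have "real (Suc m) / (real n + 1) + 1 = 2 * real n / (real n + 1)"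
    by (simp add: m field_simps)
  finally show ?thesis
    by (simp add: b m)
qed

end
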